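(* Let $(\mathcal{X},\mathcal{F},\nu)$ be a Renyi space with bunch $\mathcal{B}\subset\mathcal{F}$ and family of probability measures $\{\nu(\cdot\mid B)\mid B\in\mathcal{B}\}$. Then there exists a unique C-measure $\gamma=[\mu]$ on $(\mathcal{X},\mathcal{F})$ (that is, a $\sigma$-finite measure $\mu$ on $(\mathcal{X},\mathcal{F})$, unique up to multiplication by a positive real constant) such that every $B\in\mathcal{B}$ is admissible for $\mu$ and $$\mu(A\mid B)=\frac{\mu(A\cap B)}{\mu(B)}=\nu(A\mid B)\qquad\text{for all } A\in\mathcal{F},\ B\in\mathcal{B}.$$ Moreover, the Renyi space generated by $\gamma$, namely $(\mathcal{X},\mathcal{F})$ equipped with the family $\{\mu(\cdot\mid A)\mid A\in\mathcal{F},\ 0<\mu(A)<\infty\}$, is a maximal Renyi space that extends $(\mathcal{X},\mathcal{F},\nu)$.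
   Context: Let $\mathcal{X}$ be a nonempty set equipped with a $\sigma$-field $\mathcal{F}$. **C-measures.** For a measure $\mu:\mathcal{F}\to[0,\infty]$, a set $A\in\mathcal{F}$ is admissible if $0<\mu(A)<\infty$. The measure $\mu$ is $\sigma$-finite if there is a sequence $A_1,A_2,\ldots$ of admissible sets with $\mathcal{X}=\bigcup_i A_i$. Two $\sigma$-finite measures $\mu,\nu$ on $(\mathcal{X},\mathcal{F})$ are equivalent if $\mu=\alpha\nu$ for some real $\alpha>0$; an equivalence class $\gamma=[\mu]$ is called a C-measure (or conditional measure), and $(\mathcal{X},\mathcal{F},\gamma)$ is a C-measure space (equivalently, conditional measure space or conditional probability space). For $\gamma=[\mu]$ and $A$ admissible, $\gamma(B\mid A)=\mu(B\mid A)=\mu(B\cap A)/\mu(A)$ for $B\in\mathcal{F}$; admissibility and this value do not depend on the representative $\mu$. **Bunch.** A family $\mathcal{B}\subset\mathcal{F}$ is a bunch in $\mathcal{X}$ if (1) $B_1,B_2\in\mathcal{B}$ implies $B_1\cup B_2\in\mathcal{B}$; (2) there exist $B_1,B_2,\ldots\in\mathcal{B}$ with $\bigcup_i B_i=\mathcal{X}$; (3) $\emptyset\notin\mathcal{B}$. **Renyi space.** A Renyi space $(\mathcal{X},\mathcal{F},\nu)$ is a measurable space $(\mathcal{X},\mathcal{F})$ equipped with a family $\{\nu(\cdot\mid B)\mid B\in\mathcal{B}\}$ of probability measures on $(\mathcal{X},\mathcal{F})$ indexed by a bunch $\mathcal{B}$ such that whenever $B_1,B_2\in\mathcal{B}$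 and $B_1\subset B_2$, one has $\nu(B_1\mid B_2)>0$ and $$\nu(A\mid B_1)=\frac{\nu(A\cap B_1\mid B_2)}{\nu(B_1\mid B_2)}\quad\text{for all }A\in\mathcal{F}.$$ **Extensions.** A Renyi space $(\mathcal{X},\mathcal{F},\nu_2)$ with bunch $\mathcal{B}_2$ extends a Renyi space $(\mathcal{X},\mathcal{F},\nu_1)$ with bunch $\mathcal{B}_1$ if $\mathcal{B}_1\subset\mathcal{B}_2$ and $\nu_1(\cdot\mid B)=\nu_2(\cdot\mid B)$ for all $B\in\mathcal{B}_1$. The extension is strict if $\mathcal{B}_1\neq\mathcal{B}_2$. A Renyi space is maximal if it has no strict extension. **Renyi space generated by a C-measure.** A C-measure space $(\mathcal{X},\mathcal{F},[\mu])$ generates the Renyi space whose bunch is the family of all admissible sets $A$ and whose probability measures are $\mu(\cdot\mid A)$. *)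

theory Defs
  imports "HOL-Probability.Probability_Measure"
begin

section \<open>C-measures\<close>

definition admissible :: "'a measure \<Rightarrow> 'a set \<Rightarrow> bool" where
  "admissible \<mu> A \<longleftrightarrow> A \<in> sets \<mu> \<and> 0 < emeasure \<mu> A \<and> emeasure \<mu> A < \<infinity>"

text \<open>The cover consists of admissible sets, so this differs from
  \<^const>\<open>sigma_finite_measure\<close> in excluding the zero measure
  (see \<open>sigma_finite_on_iff\<close> below).\<close>

definition sigma_finite_on :: "'a set \<Rightarrow> 'a set set \<Rightarrow> 'a measure \<Rightarrow> bool" where
  "sigma_finite_on X F \<mu> \<longleftrightarrow>
     space \<mu> = X \<and> sets \<mu> = F \<and>
     (\<exists>A :: nat \<Rightarrow> 'a set. (\<forall>i. admissible \<mu> (A i)) \<and> (\<Union>i. A i) = X)"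

definition proportional :: "'a set \<Rightarrow> 'a set set \<Rightarrow> ('a measure \<times> 'a measure) set" where
  "proportional X F =
     {(\<mu>, \<nu>). sigma_finite_on X F \<mu> \<and> sigma_finite_on X F \<nu> \<and>
               (\<exists>\<alpha>::real. \<alpha> > 0 \<and> \<mu> = scale_measure (ennreal \<alpha>) \<nu>)}"

definition C_measures :: "'a set \<Rightarrow> 'a set set \<Rightarrow> 'a measure set set" where
  "C_measures X F = {\<mu>. sigma_finite_on X F \<mu>} // proportional X F"

definition C_admissible_sets :: "'a measure set \<Rightarrow> 'a set set" where
  "C_admissible_sets \<gamma> = {A. \<exists>\<mu>\<in>\<gamma>. admissible \<mu> A}"

text \<open>\<^term>\<open>uniform_measure \<mu> A\<close> is the conditional measure \<open>\<mu>(\<cdot> | A)\<close>, for an arbitrary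
  measure \<open>\<mu>\<close>; see \<open>emeasure_uniform_measure\<close>. The definite description is justified by
  \<open>C_cond_eq\<close> below: for admissible \<open>A\<close> all representatives give the same measure.\<close>

definition C_cond :: "'a measure set \<Rightarrow> 'a set \<Rightarrow> 'a measure" where
  "C_cond \<gamma> A = (THE \<kappa>. \<exists>\<mu>\<in>\<gamma>. \<kappa> = uniform_measure \<mu> A)"


section \<open>Renyi spaces\<close>

definition bunch :: "'a set \<Rightarrow> 'a set set \<Rightarrow> 'a set set \<Rightarrow> bool" where
  "bunch X F \<B> \<longleftrightarrow>
     \<B> \<subseteq> F \<and>
     (\<forall>B1\<in>\<B>. \<forall>B2\<in>\<B>. B1 \<union> B2 \<in> \<B>) \<and>
     (\<exists>B :: nat \<Rightarrow> 'a set. (\<forall>i. B i \<in> \<B>) \<and> (\<Union>i. B i) = X) \<and>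
     {} \<notin> \<B>"

text \<open>\<open>\<nu> B\<close> is \<open>\<nu>(\<cdot> | B)\<close>; the values of \<open>\<nu>\<close> outside \<open>\<B>\<close> are irrelevant throughout.\<close>

definition renyi_space ::
  "'a set \<Rightarrow> 'a set set \<Rightarrow> 'a set set \<Rightarrow> ('a set \<Rightarrow> 'a measure) \<Rightarrow> bool" where
  "renyi_space X F \<B> \<nu> \<longleftrightarrow>
     X \<noteq> {} \<and> sigma_algebra X F \<and> bunch X F \<B> \<and>
     (\<forall>B\<in>\<B>. prob_space (\<nu> B) \<and> space (\<nu> B) = X \<and> sets (\<nu> B) = F) \<and>
     (\<forall>B1\<in>\<B>. \<forall>B2\<in>\<B>. B1 \<subseteq> B2 \<longrightarrow>
        emeasure (\<nu> B2) B1 > 0 \<and>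
        (\<forall>A\<in>F. emeasure (\<nu> B1) A = emeasure (\<nu> B2) (A \<inter> B1) / emeasure (\<nu> B2) B1))"

definition renyi_extends ::
  "'a set \<Rightarrow> 'a set set \<Rightarrow> 'a set set \<Rightarrow> ('a set \<Rightarrow> 'a measure) \<Rightarrow>
   'a set set \<Rightarrow> ('a set \<Rightarrow> 'a measure) \<Rightarrow> bool" where
  "renyi_extends X F \<B>2 \<nu>2 \<B>1 \<nu>1 \<longleftrightarrow>
     renyi_space X F \<B>2 \<nu>2 \<and> renyi_space X F \<B>1 \<nu>1 \<and>
     \<B>1 \<subseteq> \<B>2 \<and> (\<forall>B\<in>\<B>1. \<nu>1 B = \<nu>2 B)"

definition maximal_renyi_space ::
  "'a set \<Rightarrow> 'a set set \<Rightarrow> 'a set set \<Rightarrow> ('a set \<Rightarrow> 'a measure) \<Rightarrow> bool" where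
  "maximal_renyi_space X F \<B> \<nu> \<longleftrightarrow>
     renyi_space X F \<B> \<nu> \<and>
     \<not> (\<exists>\<B>' \<nu>'. renyi_extends X F \<B>' \<nu>' \<B> \<nu> \<and> \<B> \<noteq> \<B>')"


text \<open>\<open>\<gamma>\<close> is a C-measure whose conditional probabilities given the members of \<open>\<B>\<close>
  are those of \<open>\<nu>\<close>.\<close>

definition represents ::
  "'a set \<Rightarrow> 'a set set \<Rightarrow> 'a measure set \<Rightarrow> 'a set set \<Rightarrow> ('a set \<Rightarrow> 'a measure) \<Rightarrow> bool" where
  "represents X F \<gamma> \<B> \<nu> \<longleftrightarrow>
     \<gamma> \<in> C_measures X F \<and>
     (\<forall>\<mu>\<in>\<gamma>. \<forall>B\<in>\<B>. admissible \<mu> B \<and>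
        (\<forall>A\<in>F. emeasure \<mu> (A \<inter> B) / emeasure \<mu> B = emeasure (\<nu> B) A))"


section \<open>Independence of representatives\<close>

lemma sigma_finite_on_iff:
  assumes "X \<noteq> {}"
  shows "sigma_finite_on X F \<mu> \<longleftrightarrow>
    space \<mu> = X \<and> sets \<mu> = F \<and> sigma_finite_measure \<mu> \<and> emeasure \<mu> X \<noteq> 0"
proof (intro iffI conjI)
  assume s: "sigma_finite_on X F \<mu>"
  then obtain A :: "nat \<Rightarrow> 'a set" where sp: "space \<mu> = X" and F: "sets \<mu> = F"
    and A: "\<And>i. admissible \<mu> (A i)" and U: "(\<Union>i. A i) = X"
    by (auto simp: sigma_finite_on_def)
  show "space \<mu> = X" "sets \<mu> = F" by fact+
  show "sigma_finite_measure \<mu>"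
  proof
    have "range A \<subseteq> sets \<mu>" "\<Union>(range A) = space \<mu>" "\<forall>a\<in>range A. emeasure \<mu> a \<noteq> \<infinity>"
      using A U sp by (auto simp: admissible_def less_top[symmetric])
    then show "\<exists>A. countable A \<and> A \<subseteq> sets \<mu> \<and> \<Union>A = space \<mu> \<and> (\<forall>a\<in>A. emeasure \<mu> a \<noteq> \<infinity>)"
      by (intro exI[of _ "range A"]) simp
  qed
  have "emeasure \<mu> (A 0) \<le> emeasure \<mu> X"
    using sp emeasure_space[of \<mu> "A 0"] by simp
  then show "emeasure \<mu> X \<noteq> 0"
    using A[of 0] by (auto simp: admissible_def)
next
  assume s: "space \<mu> = X \<and> sets \<mu> = F \<and> sigma_finite_measure \<mu> \<and> emeasure \<mu> X \<noteq> 0"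
  then interpret sigma_finite_measure \<mu> by simp
  obtain A :: "nat \<Rightarrow> 'a set" where A: "range A \<subseteq> sets \<mu>" "(\<Union>i. A i) = space \<mu>"
    "\<And>i. emeasure \<mu> (A i) \<noteq> \<infinity>"
    using sigma_finite by metis
  have "\<exists>i. emeasure \<mu> (A i) \<noteq> 0"
  proof (rule ccontr)
    assume "\<nexists>i. emeasure \<mu> (A i) \<noteq> 0"
    then have "emeasure \<mu> (\<Union>i. A i) = 0"
      using A by (intro emeasure_UN_eq_0) auto
    with s A show False by simp
  qed
  then obtain k where k: "emeasure \<mu> (A k) \<noteq> 0" by blast
  have "admissible \<mu> (A i \<union> A k)" for i
  proof -
    have "emeasure \<mu> (A k) \<le> emeasure \<mu> (A i \<union> A k)"
      using A by (intro emeasure_mono) auto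
    moreover have "emeasure \<mu> (A i \<union> A k) \<le> emeasure \<mu> (A i) + emeasure \<mu> (A k)"
      using A by (intro emeasure_subadditive) auto
    moreover have "emeasure \<mu> (A i) + emeasure \<mu> (A k) < \<infinity>"
      using A(3) by (simp add: less_top)
    ultimately show ?thesis
      using k A(1) unfolding admissible_def
      by (meson le_less_trans less_le_trans not_gr_zero range_subsetD sets.Un)
  qed
  moreover have "(\<Union>i. A i \<union> A k) = X" using A(2) s by auto
  ultimately show "sigma_finite_on X F \<mu>"
    using s unfolding sigma_finite_on_def by (intro conjI exI[of _ "\<lambda>i. A i \<union> A k"]) auto
qed

lemma equiv_proportional: "equiv {\<mu>. sigma_finite_on X F \<mu>} (proportional X F)"
proof (rule equivI)
  show "proportional X F \<subseteq> {\<mu>. sigma_finite_on X F \<mu>} \<times> {\<mu>. sigma_finite_on X F \<mu>}"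
    by (auto simp: proportional_def)
  show "refl_on {\<mu>. sigma_finite_on X F \<mu>} (proportional X F)"
    by (auto simp: refl_on_def proportional_def intro!: exI[of _ "1::real"])
  show "sym (proportional X F)"
  proof (rule symI)
    fix \<mu> \<nu> assume "(\<mu>, \<nu>) \<in> proportional X F"
    then obtain a :: real where a: "a > 0" "\<mu> = scale_measure (ennreal a) \<nu>"
      and s: "sigma_finite_on X F \<mu>" "sigma_finite_on X F \<nu>"
      by (auto simp: proportional_def)
    have "ennreal (inverse a) * ennreal a = 1"
      using a by (simp flip: ennreal_mult)
    then have "\<nu> = scale_measure (ennreal (inverse a)) \<mu>"
      using a by (simp add: scale_scale_measure)
    then show "(\<nu>, \<mu>) \<in> proportional X F"
      using a(1) s unfolding proportional_def
      by (auto intro!: exI[of _ "inverse a"])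
  qed
  show "trans (proportional X F)"
  proof (rule transI)
    fix \<mu> \<nu> \<kappa> assume "(\<mu>, \<nu>) \<in> proportional X F" "(\<nu>, \<kappa>) \<in> proportional X F"
    then obtain a b :: real where a: "a > 0" "\<mu> = scale_measure (ennreal a) \<nu>"
      and b: "b > 0" "\<nu> = scale_measure (ennreal b) \<kappa>"
      and s: "sigma_finite_on X F \<mu>" "sigma_finite_on X F \<kappa>"
      by (auto simp: proportional_def)
    have "\<mu> = scale_measure (ennreal (a * b)) \<kappa>"
      using a b by (simp add: scale_scale_measure ennreal_mult)
    then show "(\<mu>, \<kappa>) \<in> proportional X F"
      using a(1) b(1) s unfolding proportional_def
      by (auto intro!: exI[of _ "a * b"])
  qed
qed

lemma C_measures_proportional:
  assumes "\<gamma> \<in> C_measures X F" "\<mu> \<in> \<gamma>" "\<nu> \<in> \<gamma>"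
  shows "(\<mu>, \<nu>) \<in> proportional X F"
  using assms quotient_eq_iff[OF equiv_proportional, of \<gamma> X F \<gamma> \<mu> \<nu>]
  by (simp add: C_measures_def)

lemma admissible_scale_measure:
  assumes "(a::real) > 0"
  shows "admissible (scale_measure (ennreal a) \<mu>) A \<longleftrightarrow> admissible \<mu> A"
  using assms by (auto simp: admissible_def ennreal_zero_less_mult_iff ennreal_mult_less_top)

lemma C_admissible_sets_eq:
  assumes "\<gamma> \<in> C_measures X F" "\<mu> \<in> \<gamma>"
  shows "C_admissible_sets \<gamma> = {A. admissible \<mu> A}"
proof -
  have "admissible \<mu> A" if "\<nu> \<in> \<gamma>" "admissible \<nu> A" for \<nu> A
    using C_measures_proportional[OF assms that(1)] that(2)
    by (auto simp: proportional_def admissible_scale_measure)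
  then show ?thesis using assms(2) by (auto simp: C_admissible_sets_def)
qed

lemma uniform_measure_scale_measure:
  assumes "(a::real) > 0" "admissible \<mu> A"
  shows "uniform_measure (scale_measure (ennreal a) \<mu>) A = uniform_measure \<mu> A"
proof (rule measure_eqI)
  fix B assume "B \<in> sets (uniform_measure (scale_measure (ennreal a) \<mu>) A)"
  then have B: "B \<in> sets \<mu>" by simp
  have "ennreal a * emeasure \<mu> (A \<inter> B) / (ennreal a * emeasure \<mu> A)
      = emeasure \<mu> (A \<inter> B) / emeasure \<mu> A"
    using assms by (simp add: mult.commute[of "ennreal a"] divide_mult_eq)
  then show "emeasure (uniform_measure (scale_measure (ennreal a) \<mu>) A) B
      = emeasure (uniform_measure \<mu> A) B"
    using assms B by (simp add: admissible_def)
qed simp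

lemma C_cond_eq:
  assumes "\<gamma> \<in> C_measures X F" "\<mu> \<in> \<gamma>" "admissible \<mu> A"
  shows "C_cond \<gamma> A = uniform_measure \<mu> A"
  unfolding C_cond_def
proof (rule the_equality)
  show "\<exists>\<mu>'\<in>\<gamma>. uniform_measure \<mu> A = uniform_measure \<mu>' A" using assms(2) by blast
  fix \<kappa> assume "\<exists>\<mu>'\<in>\<gamma>. \<kappa> = uniform_measure \<mu>' A"
  then show "\<kappa> = uniform_measure \<mu> A"
    using C_measures_proportional[OF assms(1) _ assms(2)] uniform_measure_scale_measure assms(3)
    by (fastforce simp: proportional_def)
qed

lemma emeasure_C_cond:
  assumes "\<gamma> \<in> C_measures X F" "\<mu> \<in> \<gamma>" "admissible \<mu> A" "B \<in> F"
  shows "emeasure (C_cond \<gamma> A) B = emeasure \<mu> (B \<inter> A) / emeasure \<mu> A"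
proof -
  have "sets \<mu> = F"
    using C_measures_proportional[OF assms(1,2,2)] by (auto simp: proportional_def sigma_finite_on_def)
  then show ?thesis
    using assms by (simp add: C_cond_eq admissible_def Int_commute)
qed

end

(* Fix C in the bunch. In the sought measure the ratio mu B / mu C must be nu(B | E) / nu(C | E)
   for every E in the bunch containing both sets, and this number does not depend on E. Rescaling
   nu(. | B) by it makes the family consistent: for B1 inside B2 the first rescaled measure is the
   restriction of the second. Along an increasing sequence in the bunch that exhausts X the
   rescaled measures increase, and mu is their supremum. The same sequence gives uniqueness.
   Maximality is a consequence of both: the measure representing an extension also represents
   the generated space, hence is proportional to mu and has the same admissible sets. *)

theory Submission
  imports Defs
begin

section \<open>Measures representing a family of conditional probabilities\<close>

text \<open>The counterpart of \<open>represents\<close> for one measure. Construction and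
  comparison are done at this level, and the quotient by scaling enters only at the end.\<close>

definition represented_by ::
  "'a set \<Rightarrow> 'a set set \<Rightarrow> 'a measure \<Rightarrow> 'a set set \<Rightarrow> ('a set \<Rightarrow> 'a measure) \<Rightarrow> bool" where
  "represented_by X F \<mu> \<B> \<nu> \<longleftrightarrow>
     sigma_finite_on X F \<mu> \<and>
     (\<forall>B\<in>\<B>. admissible \<mu> B \<and>
        (\<forall>A\<in>F. emeasure \<mu> (A \<inter> B) / emeasure \<mu> B = emeasure (\<nu> B) A))"

lemma C_measures_sigma_finite_on:
  assumes "\<gamma> \<in> C_measures X F" "\<mu> \<in> \<gamma>"
  shows "sigma_finite_on X F \<mu>"
  using C_measures_proportional[OF assms(1,2,2)] by (simp add: proportional_def)

lemma C_measures_nonempty: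
  assumes "\<gamma> \<in> C_measures X F"
  obtains \<mu> where "\<mu> \<in> \<gamma>"
  using assms in_quotient_imp_non_empty[OF equiv_proportional] unfolding C_measures_def by blast

text \<open>Admissible sets and conditional values are invariants of the class, so one
  representative decides.\<close>

lemma represents_iff:
  assumes "\<gamma> \<in> C_measures X F" "\<mu> \<in> \<gamma>"
  shows "represents X F \<gamma> \<B> \<nu> \<longleftrightarrow> represented_by X F \<mu> \<B> \<nu>"
proof
  assume "represents X F \<gamma> \<B> \<nu>"
  then show "represented_by X F \<mu> \<B> \<nu>"
    using assms C_measures_sigma_finite_on by (auto simp: represents_def represented_by_def)
next
  assume r: "represented_by X F \<mu> \<B> \<nu>"
  have "admissible \<mu>' B \<and>
      (\<forall>A\<in>F. emeasure \<mu>' (A \<inter> B) / emeasure \<mu>' B = emeasure (\<nu> B) A)"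
    if m: "\<mu>' \<in> \<gamma>" and B: "B \<in> \<B>" for \<mu>' B
  proof -
    have adm: "admissible \<mu> B" using r B by (simp add: represented_by_def)
    have adm': "admissible \<mu>' B"
      using C_admissible_sets_eq[OF assms] C_admissible_sets_eq[OF assms(1) m] adm by auto
    have "emeasure \<mu>' (A \<inter> B) / emeasure \<mu>' B = emeasure (\<nu> B) A" if A: "A \<in> F" for A
      \<comment> \<open>Both quotients are values of the same measure
        \<open>C_cond \<gamma> B\<close>, which links \<mu>' to \<mu>.\<close>
      using emeasure_C_cond[OF assms adm A] emeasure_C_cond[OF assms(1) m adm' A] r A B
      by (simp add: represented_by_def)
    with adm' show ?thesis by blast
  qed
  with assms(1) show "represents X F \<gamma> \<B> \<nu>" by (auto simp: represents_def)
qed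

text \<open>The quotient condition with its denominator cleared; admissibility makes
  \<open>emeasure \<mu> B\<close> positive and finite, so it cancels in
  \<open>ennreal\<close>.\<close>

lemma represented_by_emeasure_Int:
  assumes "represented_by X F \<mu> \<B> \<nu>" "B \<in> \<B>" "A \<in> F"
  shows "emeasure \<mu> (A \<inter> B) = emeasure (\<nu> B) A * emeasure \<mu> B"
proof -
  have "admissible \<mu> B" and eq: "emeasure (\<nu> B) A = emeasure \<mu> (A \<inter> B) / emeasure \<mu> B"
    using assms by (auto simp: represented_by_def)
  then have "emeasure \<mu> B / emeasure \<mu> B = 1"
    by (intro ennreal_divide_self) (auto simp: admissible_def)
  then show ?thesis by (simp add: eq ennreal_divide_times)
qed

section \<open>The supremum of the rescaled conditional probabilities\<close>

locale renyi =
  fixes X :: "'a set" and F :: "'a set set"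
    and \<B> :: "'a set set" and \<nu> :: "'a set \<Rightarrow> 'a measure"
  assumes renyi: "renyi_space X F \<B> \<nu>"
begin

lemma bunch: "bunch X F \<B>"
  and nonempty: "X \<noteq> {}"
  and sigma_algebra: "sigma_algebra X F"
  using renyi unfolding renyi_space_def by blast+

lemma sets_nu [simp]: "B \<in> \<B> \<Longrightarrow> sets (\<nu> B) = F"
  and space_nu [simp]: "B \<in> \<B> \<Longrightarrow> space (\<nu> B) = X"
  and prob_space_nu: "B \<in> \<B> \<Longrightarrow> prob_space (\<nu> B)"
  using renyi unfolding renyi_space_def by blast+

lemma Un_in [simp]: "B \<in> \<B> \<Longrightarrow> C \<in> \<B> \<Longrightarrow> B \<union> C \<in> \<B>"
  and in_F [simp]: "B \<in> \<B> \<Longrightarrow> B \<in> F"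
  using bunch by (auto simp: bunch_def)

lemma Int_in_F [simp]: "A \<in> F \<Longrightarrow> B \<in> F \<Longrightarrow> A \<inter> B \<in> F"
proof -
  interpret S: sigma_algebra X F by (rule sigma_algebra)
  show "A \<in> F \<Longrightarrow> B \<in> F \<Longrightarrow> A \<inter> B \<in> F" by (rule S.Int)
qed

text \<open>Probability measures are finite, so the quotient identities can be moved to
  \<open>real\<close>, where cancellation is field arithmetic.\<close>

lemma emeasure_nu: "B \<in> \<B> \<Longrightarrow> emeasure (\<nu> B) A = ennreal (measure (\<nu> B) A)"
  using prob_space_nu by (simp add: finite_measure.emeasure_eq_measure prob_space_def)

lemma measure_nu_pos:
  assumes "B \<in> \<B>" "E \<in> \<B>" "B \<subseteq> E"
  shows "0 < measure (\<nu> E) B"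
proof -
  have "0 < emeasure (\<nu> E) B" using assms renyi unfolding renyi_space_def by blast
  then show ?thesis using assms by (simp add: emeasure_nu)
qed

lemma measure_nu_eq:
  assumes "B \<in> \<B>" "E \<in> \<B>" "B \<subseteq> E" "A \<in> F"
  shows "measure (\<nu> B) A = measure (\<nu> E) (A \<inter> B) / measure (\<nu> E) B"
proof -
  have "emeasure (\<nu> B) A = emeasure (\<nu> E) (A \<inter> B) / emeasure (\<nu> E) B"
    using assms renyi unfolding renyi_space_def by blast
  then show ?thesis
    using assms measure_nu_pos[OF assms(1-3)] by (simp add: emeasure_nu divide_ennreal)
qed

text \<open>Concentration on \<open>B\<close> comes from the compatibility rule with all three sets
  equal to \<open>B\<close>: a positive number divided by itself.\<close>

lemma measure_nu_self [simp]:
  assumes "B \<in> \<B>"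
  shows "measure (\<nu> B) B = 1"
  using measure_nu_eq[of B B B] measure_nu_pos[of B B] assms by simp

section \<open>Consistent rescaling of the conditional probabilities\<close>

text \<open>The prospective ratio of the masses of \<open>B\<close> and \<open>C\<close>, read off
  inside \<open>B \<union> C\<close>, the smallest set containing both.\<close>

definition weight :: "'a set \<Rightarrow> 'a set \<Rightarrow> real" where
  "weight C B = measure (\<nu> (B \<union> C)) B / measure (\<nu> (B \<union> C)) C"

lemma weight_pos:
  assumes "B \<in> \<B>" "C \<in> \<B>"
  shows "0 < weight C B"
  using assms unfolding weight_def by (auto intro!: divide_pos_pos measure_nu_pos)

text \<open>Passing from \<open>E\<close> to \<open>B \<union> C\<close> divides both masses by
  \<open>measure (\<nu> E) (B \<union> C)\<close>, which cancels in the ratio.\<close>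

lemma weight_eq:
  assumes "B \<in> \<B>" "C \<in> \<B>" "E \<in> \<B>" "B \<subseteq> E" "C \<subseteq> E"
  shows "weight C B = measure (\<nu> E) B / measure (\<nu> E) C"
proof -
  have D: "B \<union> C \<in> \<B>" "B \<union> C \<subseteq> E" using assms by auto
  have "B \<inter> (B \<union> C) = B" "C \<inter> (B \<union> C) = C" by auto
  then show ?thesis
    using measure_nu_eq[OF D(1) assms(3) D(2), of B] measure_nu_eq[OF D(1) assms(3) D(2), of C]
      measure_nu_pos[OF D(1) assms(3) D(2)] assms
    by (simp add: weight_def)
qed

text \<open>Seen from \<open>G = E \<union> C\<close>, both sides equal
  \<open>measure (\<nu> G) (A \<inter> B) / measure (\<nu> G) C\<close>.\<close>

lemma weight_measure_nu:
  assumes "B \<in> \<B>" "C \<in> \<B>" "E \<in> \<B>" "B \<subseteq> E" "A \<in> F"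
  shows "weight C B * measure (\<nu> B) A = weight C E * measure (\<nu> E) (A \<inter> B)"
proof -
  let ?G = "E \<union> C"
  have G: "?G \<in> \<B>" "B \<subseteq> ?G" "E \<subseteq> ?G" "C \<subseteq> ?G" using assms by auto
  have "A \<inter> B \<inter> E = A \<inter> B" using assms by auto
  then show ?thesis
    using weight_eq[of B C ?G] weight_eq[of E C ?G] measure_nu_eq[of B ?G A]
      measure_nu_eq[of E ?G "A \<inter> B"] measure_nu_pos[of B ?G] measure_nu_pos[of E ?G] assms G
    by simp
qed

text \<open>The candidate for the restriction of the sought measure to \<open>B\<close>, normalised
  so that \<open>C\<close> has mass 1.\<close>

definition rescaled :: "'a set \<Rightarrow> 'a set \<Rightarrow> 'a measure" where
  "rescaled C B = scale_measure (ennreal (weight C B)) (\<nu> B)"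

lemma sets_rescaled [simp]: "B \<in> \<B> \<Longrightarrow> sets (rescaled C B) = F"
  by (simp add: rescaled_def)

lemma emeasure_rescaled:
  assumes "B \<in> \<B>" "C \<in> \<B>"
  shows "emeasure (rescaled C B) A = ennreal (weight C B * measure (\<nu> B) A)"
  using assms weight_pos[of B C] by (simp add: rescaled_def emeasure_nu ennreal_mult)

lemma emeasure_rescaled_subset:
  assumes "B \<in> \<B>" "C \<in> \<B>" "E \<in> \<B>" "B \<subseteq> E" "A \<in> F"
  shows "emeasure (rescaled C B) A = emeasure (rescaled C E) (A \<inter> B)"
  using assms weight_measure_nu[OF assms] by (simp add: emeasure_rescaled)

text \<open>Any two rescaled measures agree on the overlap. They are compared inside
  \<open>B \<union> E\<close>, because \<open>B \<inter> E\<close> may lie outside the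
  bunch.\<close>

lemma emeasure_rescaled_Int:
  assumes "B \<in> \<B>" "C \<in> \<B>" "E \<in> \<B>" "A \<in> F"
  shows "emeasure (rescaled C E) (A \<inter> B) = emeasure (rescaled C B) (A \<inter> E)"
proof -
  have "A \<inter> B \<inter> E = A \<inter> E \<inter> B" by auto
  then show ?thesis
    using emeasure_rescaled_subset[of E C "B \<union> E" "A \<inter> B"]
      emeasure_rescaled_subset[of B C "B \<union> E" "A \<inter> E"] assms by simp
qed

lemma rescaled_mono:
  assumes "B \<in> \<B>" "C \<in> \<B>" "E \<in> \<B>" "B \<subseteq> E"
  shows "rescaled C B \<le> rescaled C E"
proof -
  \<comment> \<open>For equal sigma-fields the order on measures compares values at all sets,
    including nonmeasurable ones, where both values are 0.\<close>
  have "emeasure (rescaled C B) A \<le> emeasure (rescaled C E) A" for A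
  proof (cases "A \<in> F")
    case True
    then show ?thesis
      using emeasure_rescaled_subset[OF assms] assms by (simp add: emeasure_mono)
  next
    case False
    then show ?thesis using assms by (simp add: emeasure_notin_sets)
  qed
  then show ?thesis using assms by (simp add: le_measure le_fun_def)
qed

section \<open>Construction of the measure along an exhaustion\<close>

lemma obtain_exhaustion:
  obtains C :: "nat \<Rightarrow> 'a set" where "\<And>n. C n \<in> \<B>" "incseq C" "(\<Union>n. C n) = X"
proof -
  obtain B :: "nat \<Rightarrow> 'a set" where B: "\<And>i. B i \<in> \<B>" "(\<Union>i. B i) = X"
    using bunch by (auto simp: bunch_def)
  \<comment> \<open>With \<open>i \<le> n\<close> the union at index 0 is \<open>B 0\<close>; a
    strict bound would start with the empty set, which no bunch contains.\<close>
  have "(\<Union>i\<le>n. B i) \<in> \<B>" for n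
    by (induction n) (auto simp: atMost_Suc B)
  moreover have "incseq (\<lambda>n. \<Union>i\<le>n. B i)"
    by (force simp: incseq_def)
  moreover have "(\<Union>n. \<Union>i\<le>n. B i) = X"
    using B(2) by auto
  ultimately show ?thesis by (rule that)
qed

lemma SUP_emeasure_Int_exhaustion:
  assumes "sets M = F" "\<And>n. C n \<in> \<B>" "incseq C" "(\<Union>n. C n) = X" "A \<in> F"
  shows "(SUP n. emeasure M (A \<inter> C n)) = emeasure M A"
proof -
  \<comment> \<open>The space of \<open>M\<close> is recovered from its sets by comparison with
    \<open>\<nu> (C 0)\<close>.\<close>
  have "A \<subseteq> X"
    using assms(1,5) sets_eq_imp_space_eq[of M "\<nu> (C 0)"] sets.sets_into_space[of A M]
      assms(2)[of 0] by simp
  then have "(\<Union>n. A \<inter> C n) = A" using assms(4) by auto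
  moreover have "incseq (\<lambda>n. A \<inter> C n)" using assms(3) by (force simp: incseq_def)
  ultimately show ?thesis
    using SUP_emeasure_incseq[of "\<lambda>n. A \<inter> C n" M] assms(1,2,5) by (simp add: image_subset_iff)
qed

lemma represented_by_exists: "\<exists>\<mu>. represented_by X F \<mu> \<B> \<nu>"
proof -
  obtain C :: "nat \<Rightarrow> 'a set" where C: "\<And>n. C n \<in> \<B>" "incseq C" "(\<Union>n. C n) = X"
    by (rule obtain_exhaustion) blast
  \<comment> \<open>The reference set is \<open>C 0\<close>, which therefore gets mass 1 under
    \<mu>.\<close>
  define M where "M n = rescaled (C 0) (C n)" for n
  define \<mu> where "\<mu> = (SUP n. M n)"
  have sets_M: "sets (M n) = F" for n using C by (simp add: M_def)
  have mono: "M m \<le> M n" if "m \<le> n" for m n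
    unfolding M_def using that C by (intro rescaled_mono) (auto simp: incseq_def)
  have sets_mu: "sets \<mu> = F"
    unfolding \<mu>_def using sets_SUP[of UNIV M "M 0"] sets_M by simp
  have space_mu: "space \<mu> = X"
    using sets_eq_imp_space_eq[of \<mu> "\<nu> (C 0)"] sets_mu C by simp
  \<comment> \<open>Because \<open>M\<close> is increasing, the supremum of measures is the setwise
    supremum.\<close>
  have emeasure_mu: "emeasure \<mu> A = (SUP n. emeasure (M n) A)" if "A \<in> F" for A
    unfolding \<mu>_def
  proof (rule emeasure_SUP_chain[where N = "M 0"])
    show "Complete_Partial_Order.chain (\<le>) (range M)"
      unfolding Complete_Partial_Order.chain_def using mono nat_le_linear by blast
  qed (use that sets_M in auto)
  \<comment> \<open>This covers every \<open>B\<close> of the bunch, not only the sets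
    \<open>C n\<close>: the overlap identity turns \<open>M n\<close> on \<open>A \<inter> B\<close>
    into the rescaled measure of \<open>B\<close> on \<open>A \<inter> C n\<close>, and continuity
    from below removes \<open>C n\<close>.\<close>
  have Int: "emeasure \<mu> (A \<inter> B) = emeasure (rescaled (C 0) B) A"
    if "A \<in> F" "B \<in> \<B>" for A B
  proof -
    have "emeasure \<mu> (A \<inter> B) = (SUP n. emeasure (rescaled (C 0) B) (A \<inter> C n))"
      using that C(1) by (simp add: emeasure_mu M_def emeasure_rescaled_Int[of B])
    also have "\<dots> = emeasure (rescaled (C 0) B) A"
      using that C by (intro SUP_emeasure_Int_exhaustion) auto
    finally show ?thesis .
  qed
  have self: "emeasure \<mu> B = ennreal (weight (C 0) B)" if "B \<in> \<B>" for B
    using Int[of B B] that C(1) by (simp add: emeasure_rescaled)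
  have adm: "admissible \<mu> B" if "B \<in> \<B>" for B
    using that self weight_pos C(1) sets_mu by (simp add: admissible_def)
  have "emeasure \<mu> (A \<inter> B) / emeasure \<mu> B = emeasure (\<nu> B) A" if "A \<in> F" "B \<in> \<B>" for A B
    using that Int self weight_pos[OF that(2) C(1), of 0] C(1)
    by (simp add: emeasure_rescaled emeasure_nu divide_ennreal)
  moreover have "sigma_finite_on X F \<mu>"
    unfolding sigma_finite_on_def using space_mu sets_mu adm C by blast
  ultimately show ?thesis using adm unfolding represented_by_def by blast
qed

section \<open>Uniqueness up to a scalar\<close>

lemma represented_by_proportional:
  assumes "represented_by X F \<mu> \<B> \<nu>" "represented_by X F \<mu>' \<B> \<nu>"
  shows "(\<mu>, \<mu>') \<in> proportional X F"
proof -
  obtain C :: "nat \<Rightarrow> 'a set" where C: "\<And>n. C n \<in> \<B>" "incseq C" "(\<Union>n. C n) = X"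
    by (rule obtain_exhaustion) blast
  have sf: "sigma_finite_on X F \<mu>" "sigma_finite_on X F \<mu>'"
    using assms by (auto simp: represented_by_def)
  then have sets: "sets \<mu> = F" "sets \<mu>' = F" by (auto simp: sigma_finite_on_def)
  have fin: "emeasure \<kappa> B = ennreal (measure \<kappa> B) \<and> 0 < measure \<kappa> B"
    if "represented_by X F \<kappa> \<B> \<nu>" "B \<in> \<B>" for \<kappa> B
  proof -
    have "admissible \<kappa> B" using that by (simp add: represented_by_def)
    then have pos: "0 < emeasure \<kappa> B" and "emeasure \<kappa> B \<noteq> top"
      by (auto simp: admissible_def)
    from this(2) have eq: "emeasure \<kappa> B = ennreal (measure \<kappa> B)"
      by (rule emeasure_eq_ennreal_measure)
    from pos have "0 < measure \<kappa> B" unfolding eq by simp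
    with eq show ?thesis by blast
  qed
  \<comment> \<open>The factor is forced by the masses of \<open>C 0\<close>; the remaining work
    shows that it serves every \<open>C n\<close>.\<close>
  define r where "r = measure \<mu> (C 0) / measure \<mu>' (C 0)"
  have r: "0 < r" using fin assms C(1) by (simp add: r_def)
  have ratio: "emeasure \<mu> (A \<inter> C n) = ennreal r * emeasure \<mu>' (A \<inter> C n)" if A: "A \<in> F" for A n
  proof -
    have C0n: "C 0 \<subseteq> C n" using C(2) by (auto simp: incseq_def)
    \<comment> \<open>The fraction of \<open>C n\<close> occupied by \<open>C 0\<close> is
      prescribed by \<nu> and positive, hence common to both measures; the ratio of their masses at
      \<open>C n\<close> is thus again \<open>r\<close>.\<close>
    have 0: "measure \<kappa> (C 0) = measure (\<nu> (C n)) (C 0) * measure \<kappa> (C n)"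
      if "represented_by X F \<kappa> \<B> \<nu>" for \<kappa>
    proof -
      have "ennreal (measure \<kappa> (C 0)) = ennreal (measure (\<nu> (C n)) (C 0) * measure \<kappa> (C n))"
        using represented_by_emeasure_Int[OF that C(1), of "C 0" n] fin[OF that] C(1) C0n
        by (simp add: Int_absorb2 emeasure_nu ennreal_mult)
      then show ?thesis by simp
    qed
    have "measure \<mu> (C n) = r * measure \<mu>' (C n)"
      using 0[OF assms(1)] 0[OF assms(2)] measure_nu_pos[OF C(1) C(1) C0n]
        fin[OF assms(2) C(1), of n]
      by (simp add: r_def)
    then have "emeasure \<mu> (C n) = ennreal r * emeasure \<mu>' (C n)"
      using fin[OF assms(1) C(1), of n] fin[OF assms(2) C(1), of n] r
      by (simp add: ennreal_mult)
    then show ?thesis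
      using assms A C(1) by (simp add: represented_by_emeasure_Int mult.left_commute)
  qed
  have "\<mu> = scale_measure (ennreal r) \<mu>'"
  proof (rule measure_eqI)
    fix A assume "A \<in> sets \<mu>"
    then have A: "A \<in> F" using sets by simp
    have "emeasure \<mu> A = (SUP n. ennreal r * emeasure \<mu>' (A \<inter> C n))"
      using SUP_emeasure_Int_exhaustion[OF sets(1) C A] ratio[OF A] by simp
    also have "\<dots> = ennreal r * emeasure \<mu>' A"
      using SUP_emeasure_Int_exhaustion[OF sets(2) C A] by (simp only: SUP_mult_left_ennreal[symmetric])
    finally show "emeasure \<mu> A = emeasure (scale_measure (ennreal r) \<mu>') A" by simp
  qed (simp add: sets)
  then show ?thesis using sf r unfolding proportional_def by blast
qed

lemma represents_ex1: "\<exists>!\<gamma>. represents X F \<gamma> \<B> \<nu>"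
proof -
  obtain \<mu> where \<mu>: "represented_by X F \<mu> \<B> \<nu>" using represented_by_exists by blast
  then have sf: "sigma_finite_on X F \<mu>" by (simp add: represented_by_def)
  let ?\<gamma> = "proportional X F `` {\<mu>}"
  have \<gamma>: "?\<gamma> \<in> C_measures X F" "\<mu> \<in> ?\<gamma>"
    using sf equiv_class_self[OF equiv_proportional] by (auto simp: C_measures_def quotientI)
  show ?thesis
  proof (rule ex1I[of _ ?\<gamma>])
    show "represents X F ?\<gamma> \<B> \<nu>" using represents_iff[OF \<gamma>] \<mu> by blast
    fix \<gamma>' assume r: "represents X F \<gamma>' \<B> \<nu>"
    then have \<gamma>': "\<gamma>' \<in> C_measures X F" by (simp add: represents_def)
    then obtain \<mu>' where \<mu>': "\<mu>' \<in> \<gamma>'" by (rule C_measures_nonempty)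
    have "(\<mu>', \<mu>) \<in> proportional X F"
      using represented_by_proportional[OF _ \<mu>] represents_iff[OF \<gamma>' \<mu>'] r by blast
    then show "\<gamma>' = ?\<gamma>"
      using quotient_eq_iff[OF equiv_proportional, of \<gamma>' X F ?\<gamma> \<mu>' \<mu>] \<gamma> \<gamma>' \<mu>'
      by (simp add: C_measures_def)
  qed
qed

end

section \<open>The generated Renyi space\<close>

lemma admissible_Un:
  assumes "admissible \<mu> A" "admissible \<mu> B"
  shows "admissible \<mu> (A \<union> B)"
proof -
  have s: "A \<in> sets \<mu>" "B \<in> sets \<mu>" using assms by (auto simp: admissible_def)
  have "emeasure \<mu> A \<le> emeasure \<mu> (A \<union> B)" using s by (intro emeasure_mono) auto
  moreover have "emeasure \<mu> (A \<union> B) \<le> emeasure \<mu> A + emeasure \<mu> B"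
    using s by (rule emeasure_subadditive)
  moreover have "0 < emeasure \<mu> A" "emeasure \<mu> A + emeasure \<mu> B < \<infinity>"
    using assms by (auto simp: admissible_def)
  ultimately have "0 < emeasure \<mu> (A \<union> B)" "emeasure \<mu> (A \<union> B) < \<infinity>"
    using less_le_trans le_less_trans by blast+
  then show ?thesis using s by (simp add: admissible_def)
qed

lemma renyi_space_admissible:
  assumes "X \<noteq> {}" "sigma_finite_on X F \<mu>"
  shows "renyi_space X F {A. admissible \<mu> A} (uniform_measure \<mu>)"
proof -
  have sets: "sets \<mu> = F" and space: "space \<mu> = X"
    using assms by (auto simp: sigma_finite_on_def)
  have "bunch X F {A. admissible \<mu> A}"
    using assms(2) by (auto simp: bunch_def sigma_finite_on_def intro: admissible_Un)
      (auto simp: admissible_def)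
  moreover have "prob_space (uniform_measure \<mu> B) \<and> space (uniform_measure \<mu> B) = X \<and>
      sets (uniform_measure \<mu> B) = F" if "admissible \<mu> B" for B
    using that sets space prob_space_uniform_measure[of \<mu> B] by (auto simp: admissible_def)
  moreover have "0 < emeasure (uniform_measure \<mu> B2) B1 \<and>
      (\<forall>A\<in>F. emeasure (uniform_measure \<mu> B1) A =
        emeasure (uniform_measure \<mu> B2) (A \<inter> B1) / emeasure (uniform_measure \<mu> B2) B1)"
    if B: "admissible \<mu> B1" "admissible \<mu> B2" "B1 \<subseteq> B2" for B1 B2
  proof -
    have m: "B1 \<in> sets \<mu>" "B2 \<in> sets \<mu>" using B by (auto simp: admissible_def)
    have a: "0 < emeasure \<mu> B1" "emeasure \<mu> B1 < top" "0 < emeasure \<mu> B2" "emeasure \<mu> B2 < top"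
      using B by (auto simp: admissible_def)
    have "emeasure \<mu> (B1 \<inter> A) / emeasure \<mu> B1 =
        emeasure \<mu> (A \<inter> B1) / emeasure \<mu> B2 / (emeasure \<mu> B1 / emeasure \<mu> B2)" for A
    proof -
      have "emeasure \<mu> (A \<inter> B1) \<le> emeasure \<mu> B1" using m by (intro emeasure_mono) auto
      then have "emeasure \<mu> (A \<inter> B1) < top" using a by (rule_tac le_less_trans)
      \<comment> \<open>All masses are now finite, so the identity reduces to cancellation of real
        quotients.\<close>
      then show ?thesis
        using a by (cases "emeasure \<mu> (A \<inter> B1)"; cases "emeasure \<mu> B1"; cases "emeasure \<mu> B2")
          (auto simp: divide_ennreal Int_commute)
    qed
    moreover have "B2 \<inter> B1 = B1" "B2 \<inter> (A \<inter> B1) = A \<inter> B1" for A using B by auto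
    ultimately show ?thesis
      using m a sets by (auto simp: ennreal_zero_less_divide)
  qed
  moreover have "sigma_algebra X F"
    using sets.sigma_algebra_axioms[of \<mu>] sets space by simp
  ultimately show ?thesis
    using assms(1) unfolding renyi_space_def by blast
qed

lemma renyi_space_C_admissible_sets:
  assumes "X \<noteq> {}" "\<gamma> \<in> C_measures X F"
  shows "renyi_space X F (C_admissible_sets \<gamma>) (C_cond \<gamma>)"
proof -
  obtain \<mu> where \<mu>: "\<mu> \<in> \<gamma>" using assms(2) by (rule C_measures_nonempty)
  \<comment> \<open>\<open>C_cond_eq\<close> identifies the two families on admissible sets, the
    only indices at which \<open>renyi_space\<close> evaluates them here.\<close>
  have "renyi_space X F {A. admissible \<mu> A} (C_cond \<gamma>)
      \<longleftrightarrow> renyi_space X F {A. admissible \<mu> A} (uniform_measure \<mu>)"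
    unfolding renyi_space_def by (simp add: C_cond_eq[OF assms(2) \<mu>] cong: conj_cong)
  then show ?thesis
    using renyi_space_admissible assms C_measures_sigma_finite_on[OF assms(2) \<mu>]
      C_admissible_sets_eq[OF assms(2) \<mu>] by simp
qed

section \<open>Extension and maximality\<close>

text \<open>Makes the uniqueness result applicable to the generated space itself.\<close>

lemma represents_C_cond:
  assumes "\<gamma> \<in> C_measures X F"
  shows "represents X F \<gamma> (C_admissible_sets \<gamma>) (C_cond \<gamma>)"
  unfolding represents_def
  using assms C_admissible_sets_eq[OF assms] by (auto simp: emeasure_C_cond)

text \<open>Serves twice: for the given space, and in the maximality proof for an arbitrary
  extension of the generated space.\<close>

lemma represents_renyi_extends:
  assumes "renyi_space X F \<B> \<nu>" "represents X F \<gamma> \<B> \<nu>"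
  shows "renyi_extends X F (C_admissible_sets \<gamma>) (C_cond \<gamma>) \<B> \<nu>"
proof -
  have \<gamma>: "\<gamma> \<in> C_measures X F" using assms(2) by (simp add: represents_def)
  then obtain \<mu> where \<mu>: "\<mu> \<in> \<gamma>" by (rule C_measures_nonempty)
  have sets: "sets \<mu> = F"
    using C_measures_sigma_finite_on[OF \<gamma> \<mu>] by (simp add: sigma_finite_on_def)
  have adm: "admissible \<mu> B" if "B \<in> \<B>" for B
    using assms(2) \<mu> that by (simp add: represents_def)
  have "\<nu> B = C_cond \<gamma> B" if B: "B \<in> \<B>" for B
  proof (rule measure_eqI)
    have nu: "sets (\<nu> B) = F" using B by (rule renyi.sets_nu[OF renyi.intro[OF assms(1)]])
    then show "sets (\<nu> B) = sets (C_cond \<gamma> B)"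
      using C_cond_eq[OF \<gamma> \<mu> adm[OF B]] sets by simp
    fix A assume "A \<in> sets (\<nu> B)"
    then have "A \<in> F" using nu by simp
    then show "emeasure (\<nu> B) A = emeasure (C_cond \<gamma> B) A"
      using emeasure_C_cond[OF \<gamma> \<mu> adm[OF B]] assms(2) \<mu> B by (simp add: represents_def)
  qed
  moreover have "X \<noteq> {}" by (rule renyi.nonempty[OF renyi.intro[OF assms(1)]])
  ultimately show ?thesis
    using assms(1) renyi_space_C_admissible_sets[OF _ \<gamma>] C_admissible_sets_eq[OF \<gamma> \<mu>] adm
    by (auto simp: renyi_extends_def)
qed

lemma maximal_renyi_space_C_admissible_sets:
  assumes "X \<noteq> {}" "\<gamma> \<in> C_measures X F"
  shows "maximal_renyi_space X F (C_admissible_sets \<gamma>) (C_cond \<gamma>)"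
proof -
  have gen: "renyi_space X F (C_admissible_sets \<gamma>) (C_cond \<gamma>)"
    by (rule renyi_space_C_admissible_sets[OF assms])
  have "\<B> = C_admissible_sets \<gamma>"
    if ext: "renyi_extends X F \<B> \<nu> (C_admissible_sets \<gamma>) (C_cond \<gamma>)" for \<B> \<nu>
  proof
    have sub: "C_admissible_sets \<gamma> \<subseteq> \<B>" and "renyi X F \<B> \<nu>"
      using ext by (auto simp: renyi_extends_def renyi_def)
    then obtain \<gamma>' where \<gamma>': "represents X F \<gamma>' \<B> \<nu>"
      using renyi.represents_ex1 by blast
    \<comment> \<open>Representation passes to the smaller bunch, where \<nu> coincides with
      \<open>C_cond \<gamma>\<close>.\<close>
    then have "represents X F \<gamma>' (C_admissible_sets \<gamma>) (C_cond \<gamma>)"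
      using ext by (auto simp: represents_def renyi_extends_def)
    then have "\<gamma>' = \<gamma>"
      using renyi.represents_ex1[OF renyi.intro[OF gen]] represents_C_cond[OF assms(2)] by blast
    \<comment> \<open>Every set in the larger bunch is admissible for \<gamma>', hence for
      \<gamma>.\<close>
    moreover have "renyi_extends X F (C_admissible_sets \<gamma>') (C_cond \<gamma>') \<B> \<nu>"
      using ext \<gamma>' by (intro represents_renyi_extends) (auto simp: renyi_extends_def)
    ultimately show "\<B> \<subseteq> C_admissible_sets \<gamma>" by (simp add: renyi_extends_def)
    show "C_admissible_sets \<gamma> \<subseteq> \<B>" by (rule sub)
  qed
  with gen show ?thesis by (auto simp: maximal_renyi_space_def)
qed

theorem proposition3:
  fixes X :: "'a set" and F :: "'a set set"
    and \<B> :: "'a set set" and \<nu> :: "'a set \<Rightarrow> 'a measure"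
  assumes "renyi_space X F \<B> \<nu>"
  shows "(\<exists>!\<gamma>. represents X F \<gamma> \<B> \<nu>) \<and>
    (\<forall>\<gamma>. represents X F \<gamma> \<B> \<nu> \<longrightarrow>
       maximal_renyi_space X F (C_admissible_sets \<gamma>) (C_cond \<gamma>) \<and>
       renyi_extends X F (C_admissible_sets \<gamma>) (C_cond \<gamma>) \<B> \<nu>)"
proof (intro conjI allI impI)
  show "\<exists>!\<gamma>. represents X F \<gamma> \<B> \<nu>"
    by (rule renyi.represents_ex1[OF renyi.intro[OF assms]])
next
  fix \<gamma> assume r: "represents X F \<gamma> \<B> \<nu>"
  then have "\<gamma> \<in> C_measures X F" by (simp add: represents_def)
  with renyi.nonempty[OF renyi.intro[OF assms]]
  show "maximal_renyi_space X F (C_admissible_sets \<gamma>) (C_cond \<gamma>)"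
    by (rule maximal_renyi_space_C_admissible_sets)
  show "renyi_extends X F (C_admissible_sets \<gamma>) (C_cond \<gamma>) \<B> \<nu>"
    using assms r by (rule represents_renyi_extends)
qed

end
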